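(* A sequence $(d_i)_{i=1}^n$ of non-negative real numbers is the score sequence of some generalised tournament if and only if $\sum_{i\in J} d_i\geq \binom{|J|}{2}$ for all subsets $J\subseteq \{1,2,\dots,n\}$, with equality for $J=\{1,2,\dots,n\}$.
   Context: A generalised tournament $G=(V(G),\alpha)$ (on $n$ vertices) is a set $V(G)=\{1,\dots,n\}$ of vertices along with a function $\alpha:V(G)\times V(G)\to[0,1]$ (real-valued edge weights) such that $\alpha(i,j)+\alpha(j,i)=1$ for all $i,j\in V(G)$ with $i\neq j$, and $\alpha(i,i)=0$ for all $i\in V(G)$. The outdegree of a vertex $u\in V(G)$ is $\sum_{v\in V(G)}\alpha(u,v)$. The score sequence of $G$ is the sequence $(d_i)_{i=1}^n$ where $d_i$ is the outdegree of vertex $i$. *)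

theory Defs
  imports Complex_Main
begin

text \<open>The vertex set is \<open>{1..n}\<close>. A weight function is a total function on \<open>nat\<close>, of which only
  the values on \<open>{1..n} \<times> {1..n}\<close> matter; likewise only the entries \<open>d 1, \<dots>, d n\<close> of a
  sequence \<open>d\<close> matter.\<close>

definition generalised_tournament :: "nat \<Rightarrow> (nat \<Rightarrow> nat \<Rightarrow> real) \<Rightarrow> bool" where
  "generalised_tournament n \<alpha> \<longleftrightarrow>
     (\<forall>i\<in>{1..n}. \<forall>j\<in>{1..n}. \<alpha> i j \<in> {0..1}) \<and>
     (\<forall>i\<in>{1..n}. \<forall>j\<in>{1..n}. i \<noteq> j \<longrightarrow> \<alpha> i j + \<alpha> j i = 1) \<and>
     (\<forall>i\<in>{1..n}. \<alpha> i i = 0)"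

definition outdegree :: "nat \<Rightarrow> (nat \<Rightarrow> nat \<Rightarrow> real) \<Rightarrow> nat \<Rightarrow> real" where
  "outdegree n \<alpha> u = (\<Sum>v\<in>{1..n}. \<alpha> u v)"

definition is_score_sequence :: "nat \<Rightarrow> (nat \<Rightarrow> nat \<Rightarrow> real) \<Rightarrow> (nat \<Rightarrow> real) \<Rightarrow> bool" where
  "is_score_sequence n \<alpha> d \<longleftrightarrow> (\<forall>i\<in>{1..n}. d i = outdegree n \<alpha> i)"

end

theory Submission
  imports Defs "HOL-Analysis.Function_Topology"
begin

text \<open>
  Necessity is double counting: each pair of vertices inside \<open>J\<close> contributes exactly \<open>1\<close> to the
  scores of \<open>J\<close> (\<open>sum_weights_within\<close>), and the weights leaving \<open>J\<close> are non-negative.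

  Sufficiency is a variational argument. By compactness there is a generalised tournament whose
  scores are closest to \<open>d\<close> in the least-squares sense (\<open>closest_tournament_exists\<close>). Call
  \<open>d i - outdegree n \<alpha> i\<close> the deficit of \<open>i\<close>. Shifting a little weight on a pair towards the vertex
  with the larger deficit brings the scores closer to \<open>d\<close>, so at the optimum such a shift is
  impossible: the vertex with the larger deficit already wins with weight \<open>1\<close>
  (\<open>closest_tournament_larger_deficit_wins\<close>). Hence the set \<open>J\<close> of vertices of least deficit gets
  nothing from outside, and its scores sum to exactly \<open>card J choose 2\<close>. The condition on \<open>J\<close> now
  says that the deficits in \<open>J\<close> have a non-negative sum, so the least deficit is non-negative. As
  all deficits together sum to zero, they all vanish.
\<close>

section \<open>Double counting\<close>

text \<open>Adding the sum to its transpose makes every off-diagonal term \<open>1\<close>.\<close>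

lemma sum_weights_within:
  assumes "generalised_tournament n \<alpha>" "J \<subseteq> {1..n}"
  shows "(\<Sum>i\<in>J. \<Sum>j\<in>J. \<alpha> i j) = real (card J choose 2)"
proof -
  have fin: "finite J"
    using assms(2) finite_subset by blast
  have pair: "\<alpha> i j + \<alpha> j i = (if i = j then 0 else 1)" if "i \<in> J" "j \<in> J" for i j
    using assms that unfolding generalised_tournament_def by (auto simp: subset_iff)
  have "2 * (\<Sum>i\<in>J. \<Sum>j\<in>J. \<alpha> i j) = (\<Sum>i\<in>J. \<Sum>j\<in>J. \<alpha> i j) + (\<Sum>i\<in>J. \<Sum>j\<in>J. \<alpha> j i)"
    using sum.swap[of \<alpha> J J] by simp
  also have "\<dots> = (\<Sum>i\<in>J. \<Sum>j\<in>J. if i = j then 0 else 1)"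
    by (simp add: sum.distrib[symmetric] pair cong: sum.cong)
  also have "\<dots> = (\<Sum>i\<in>J. \<Sum>j\<in>J. 1 - (if i = j then 1 else 0))"
    by (intro sum.cong) auto
  also have "\<dots> = real (card J) * (real (card J) - 1)"
    using fin by (simp add: sum_subtractf algebra_simps)
  also have "\<dots> = 2 * real (card J choose 2)"
    by (cases "card J") (auto simp: choose_two real_of_nat_div algebra_simps)
  finally show ?thesis by simp
qed

lemma sum_outdegree_eq:
  assumes "generalised_tournament n \<alpha>" "J \<subseteq> {1..n}"
  shows "(\<Sum>i\<in>J. outdegree n \<alpha> i) = real (card J choose 2) + (\<Sum>i\<in>J. \<Sum>j\<in>{1..n} - J. \<alpha> i j)"
proof -
  have "outdegree n \<alpha> i = (\<Sum>j\<in>J. \<alpha> i j) + (\<Sum>j\<in>{1..n} - J. \<alpha> i j)" for i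
    unfolding outdegree_def using sum.subset_diff[OF assms(2), of "\<alpha> i"] by simp
  then show ?thesis
    using sum_weights_within[OF assms] by (simp add: sum.distrib)
qed

lemma sum_outdegree_ge:
  assumes "generalised_tournament n \<alpha>" "J \<subseteq> {1..n}"
  shows "(\<Sum>i\<in>J. outdegree n \<alpha> i) \<ge> real (card J choose 2)"
proof -
  have "0 \<le> (\<Sum>i\<in>J. \<Sum>j\<in>{1..n} - J. \<alpha> i j)"
    using assms unfolding generalised_tournament_def by (intro sum_nonneg) auto
  then show ?thesis
    using sum_outdegree_eq[OF assms] by simp
qed

section \<open>A tournament with scores closest to a given sequence\<close>

definition score_error :: "nat \<Rightarrow> (nat \<Rightarrow> real) \<Rightarrow> (nat \<Rightarrow> nat \<Rightarrow> real) \<Rightarrow> real" where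
  "score_error n d \<alpha> = (\<Sum>i\<in>{1..n}. (d i - outdegree n \<alpha> i)\<^sup>2)"

text \<open>Arbitrary weights above the diagonal determine a tournament; this parametrises the tournaments
  by a cube, where compactness is Tychonoff's theorem.\<close>

definition tournament_of_upper :: "(nat \<times> nat \<Rightarrow> real) \<Rightarrow> nat \<Rightarrow> nat \<Rightarrow> real" where
  "tournament_of_upper f i j = (if i < j then f (i, j) else if j < i then 1 - f (j, i) else 0)"

lemma generalised_tournament_of_upper:
  assumes "f \<in> UNIV \<rightarrow>\<^sub>E {0..1}"
  shows "generalised_tournament n (tournament_of_upper f)"
proof -
  have "0 \<le> f p" "f p \<le> 1" for p
    using assms by (cases p, auto simp: PiE_iff)+
  then show ?thesis
    by (auto simp: generalised_tournament_def tournament_of_upper_def)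
qed

lemma score_error_cong:
  assumes "\<And>i j. i \<in> {1..n} \<Longrightarrow> j \<in> {1..n} \<Longrightarrow> \<alpha> i j = \<beta> i j"
  shows "score_error n d \<alpha> = score_error n d \<beta>"
proof -
  have "outdegree n \<alpha> i = outdegree n \<beta> i" if "i \<in> {1..n}" for i
    unfolding outdegree_def using assms that by (intro sum.cong) auto
  then show ?thesis
    unfolding score_error_def by (intro sum.cong) auto
qed

lemma closest_tournament_exists:
  obtains \<alpha> where "generalised_tournament n \<alpha>"
    and "\<And>\<beta>. generalised_tournament n \<beta> \<Longrightarrow> score_error n d \<alpha> \<le> score_error n d \<beta>"
proof -
  define K where "K = (UNIV :: (nat \<times> nat) set) \<rightarrow>\<^sub>E {0..1::real}"
  have "compact K"
    using compactin_PiE[of "\<lambda>_. euclidean" UNIV "\<lambda>_. {0..1::real}"]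
    by (simp add: K_def euclidean_product_topology)
  moreover have "K \<noteq> {}"
    by (auto simp: K_def PiE_eq_empty_iff)
  moreover have "continuous_on K (\<lambda>f. score_error n d (tournament_of_upper f))"
  proof -
    have "continuous_on K (\<lambda>f. tournament_of_upper f i j)" for i j
    proof -
      have coord: "continuous_on K (\<lambda>f. f p)" for p
        by (rule continuous_on_subset[OF continuous_on_product_coordinates]) simp
      consider "i < j" | "j < i" | "i = j" by linarith
      then show ?thesis
        by cases (simp_all add: tournament_of_upper_def coord continuous_on_diff)
    qed
    then show ?thesis
      unfolding score_error_def outdegree_def by (intro continuous_intros)
  qed
  ultimately obtain f where f: "f \<in> K"
    and min: "\<And>g. g \<in> K \<Longrightarrow>
      score_error n d (tournament_of_upper f) \<le> score_error n d (tournament_of_upper g)"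
    using continuous_attains_inf by metis
  show ?thesis
  proof
    show "generalised_tournament n (tournament_of_upper f)"
      using f unfolding K_def by (rule generalised_tournament_of_upper)
    fix \<beta> assume \<beta>: "generalised_tournament n \<beta>"
    \<comment> \<open>Nothing is known about \<open>\<beta>\<close> outside \<open>{1..n}\<close>, so it is cut off there to obtain a point of the
      cube.\<close>
    define g where "g = (\<lambda>(i, j). if i \<in> {1..n} \<and> j \<in> {1..n} then \<beta> i j else 0)"
    have "g \<in> K"
      using \<beta> by (auto simp: g_def K_def generalised_tournament_def PiE_iff)
    moreover have "score_error n d (tournament_of_upper g) = score_error n d \<beta>"
    proof (rule score_error_cong)
      fix i j assume ij: "i \<in> {1..n}" "j \<in> {1..n}"
      consider "i < j" | "j < i" | "i = j" by linarith
      then show "tournament_of_upper g i j = \<beta> i j"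
      proof cases
        case 2
        then have "\<beta> i j + \<beta> j i = 1"
          using \<beta> ij unfolding generalised_tournament_def by (metis less_irrefl)
        then show ?thesis
          using 2 ij by (simp add: tournament_of_upper_def g_def)
      qed (use \<beta> ij in \<open>auto simp: tournament_of_upper_def g_def generalised_tournament_def\<close>)
    qed
    ultimately show "score_error n d (tournament_of_upper f) \<le> score_error n d \<beta>"
      using min by metis
  qed
qed

section \<open>Shifting weight on a pair\<close>

definition shift_weight ::
  "(nat \<Rightarrow> nat \<Rightarrow> real) \<Rightarrow> nat \<Rightarrow> nat \<Rightarrow> real \<Rightarrow> nat \<Rightarrow> nat \<Rightarrow> real" where
  "shift_weight \<alpha> a b t i j =
     \<alpha> i j + (if i = a \<and> j = b then t else 0) - (if i = b \<and> j = a then t else 0)"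

lemma generalised_tournament_shift_weight:
  assumes \<alpha>: "generalised_tournament n \<alpha>" and ab: "a \<in> {1..n}" "b \<in> {1..n}" "a \<noteq> b"
    and t: "0 \<le> t" "t \<le> 1 - \<alpha> a b"
  shows "generalised_tournament n (shift_weight \<alpha> a b t)"
proof -
  have rev: "\<alpha> b a = 1 - \<alpha> a b" and "0 \<le> \<alpha> a b"
    using \<alpha> ab by (auto simp: generalised_tournament_def eq_diff_eq)
  then have bound: "- \<alpha> a b \<le> t"
    using t by linarith
  show ?thesis
    using \<alpha> ab t by (auto simp: generalised_tournament_def shift_weight_def rev bound)
qed

lemma outdegree_shift_weight:
  assumes "a \<in> {1..n}" "b \<in> {1..n}"
  shows "outdegree n (shift_weight \<alpha> a b t) i =
    outdegree n \<alpha> i + (if i = a then t else 0) - (if i = b then t else 0)"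
proof -
  have "(\<Sum>j\<in>{1..n}. if i = c \<and> j = c' then t else 0) = (if i = c then t else 0)"
    if "c' \<in> {1..n}" for c c'
    using that by (cases "i = c") (simp_all add: sum.delta)
  then show ?thesis
    using assms by (simp add: outdegree_def shift_weight_def sum.distrib sum_subtractf)
qed

text \<open>A shift by \<open>t\<close> towards the larger deficit \<open>e a\<close> changes the error by
  \<open>2 * t * (t - (e a - e b))\<close>, which is negative for small positive \<open>t\<close>. At a closest tournament no
  such shift can be available.\<close>

lemma closest_tournament_larger_deficit_wins:
  assumes \<alpha>: "generalised_tournament n \<alpha>"
    and min: "\<And>\<beta>. generalised_tournament n \<beta> \<Longrightarrow> score_error n d \<alpha> \<le> score_error n d \<beta>"
    and ab: "a \<in> {1..n}" "b \<in> {1..n}"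
    and less: "d b - outdegree n \<alpha> b < d a - outdegree n \<alpha> a"
  shows "\<alpha> a b = 1"
proof (rule ccontr)
  assume "\<alpha> a b \<noteq> 1"
  moreover have "\<alpha> a b \<le> 1"
    using \<alpha> ab by (auto simp: generalised_tournament_def)
  ultimately have lt: "\<alpha> a b < 1" by simp
  have neq: "a \<noteq> b"
    using less by auto
  define e where "e = (\<lambda>i. d i - outdegree n \<alpha> i)"
  \<comment> \<open>Half the difference is the shift that equalises the two deficits.\<close>
  define t where "t = min (1 - \<alpha> a b) ((e a - e b) / 2)"
  have t: "0 < t" "t \<le> 1 - \<alpha> a b" "2 * t \<le> e a - e b"
    using lt less by (auto simp: t_def e_def min_def)
  let ?\<beta> = "shift_weight \<alpha> a b t"
  have "score_error n d \<alpha> \<le> score_error n d ?\<beta>"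
    using t by (intro min generalised_tournament_shift_weight \<alpha> ab neq) auto
  moreover have "score_error n d ?\<beta> = score_error n d \<alpha> + 2 * t * (t - (e a - e b))"
  proof -
    have "score_error n d ?\<beta> = (\<Sum>i\<in>{1..n}. (e i)\<^sup>2 +
        ((if i = a then t\<^sup>2 - 2 * t * e a else 0) + (if i = b then t\<^sup>2 + 2 * t * e b else 0)))"
      unfolding score_error_def outdegree_shift_weight[OF ab] e_def using neq
      by (intro sum.cong) (auto simp: power2_eq_square algebra_simps)
    also have "\<dots> = score_error n d \<alpha> + ((t\<^sup>2 - 2 * t * e a) + (t\<^sup>2 + 2 * t * e b))"
      using ab by (simp add: sum.distrib score_error_def e_def)
    finally show ?thesis
      by (simp add: power2_eq_square algebra_simps)
  qed
  moreover have "2 * t * (t - (e a - e b)) < 0"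
    using t by (intro mult_pos_neg) auto
  ultimately show False by linarith
qed

section \<open>The characterisation of score sequences\<close>

lemma tournament_with_scores_exists:
  assumes lower: "\<And>J. J \<subseteq> {1..n} \<Longrightarrow> (\<Sum>i\<in>J. d i) \<ge> real (card J choose 2)"
    and total: "(\<Sum>i\<in>{1..n}. d i) = real (card {1..n} choose 2)"
  obtains \<alpha> where "generalised_tournament n \<alpha>" "is_score_sequence n \<alpha> d"
proof -
  obtain \<alpha> where \<alpha>: "generalised_tournament n \<alpha>"
    and min: "\<And>\<beta>. generalised_tournament n \<beta> \<Longrightarrow> score_error n d \<alpha> \<le> score_error n d \<beta>"
    using closest_tournament_exists[of n d] by blast
  define e where "e = (\<lambda>i. d i - outdegree n \<alpha> i)"
  have sum_e: "(\<Sum>i\<in>{1..n}. e i) = 0"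
    using total sum_outdegree_eq[OF \<alpha> order_refl] by (simp add: e_def sum_subtractf)
  have nonneg: "0 \<le> e i" if i: "i \<in> {1..n}" for i
  proof -
    define m where "m = Min (e ` {1..n})"
    define J where "J = {k \<in> {1..n}. e k = m}"
    have m_le: "m \<le> e k" if "k \<in> {1..n}" for k
      using that by (simp add: m_def)
    have "m \<in> e ` {1..n}"
      unfolding m_def using i by (intro Min_in) auto
    then have "J \<noteq> {}" by (auto simp: J_def)
    have J: "J \<subseteq> {1..n}" by (auto simp: J_def)
    have no_gain: "\<alpha> a b = 0" if a: "a \<in> J" and b: "b \<in> {1..n} - J" for a b
    proof -
      have V: "a \<in> {1..n}" "b \<in> {1..n}" "a \<noteq> b"
        using a b by (auto simp: J_def)
      have "e a < e b"
        using a b m_le[of b] by (auto simp: J_def)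
      then have "\<alpha> b a = 1"
        using closest_tournament_larger_deficit_wins[OF \<alpha> min V(2,1)] by (simp add: e_def)
      moreover have "\<alpha> a b + \<alpha> b a = 1"
        using \<alpha> V unfolding generalised_tournament_def by blast
      ultimately show ?thesis by simp
    qed
    have "(\<Sum>k\<in>J. outdegree n \<alpha> k) = real (card J choose 2)"
      using sum_outdegree_eq[OF \<alpha> J] no_gain by simp
    then have "0 \<le> (\<Sum>k\<in>J. e k)"
      using lower[OF J] by (simp add: e_def sum_subtractf)
    also have "\<dots> = real (card J) * m"
      by (simp add: J_def)
    finally have "0 \<le> m"
      using \<open>J \<noteq> {}\<close> finite_subset[OF J] by (simp add: zero_le_mult_iff)
    then show ?thesis
      using m_le[OF i] by simp
  qed
  then have "\<forall>i\<in>{1..n}. e i = 0"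
    using sum_e sum_nonneg_eq_0_iff[of "{1..n}" e] by blast
  then have "is_score_sequence n \<alpha> d"
    by (simp add: is_score_sequence_def e_def)
  then show thesis
    using that \<alpha> by blast
qed

theorem theorem2:
  fixes n :: nat and d :: "nat \<Rightarrow> real"
  assumes "\<And>i. i \<in> {1..n} \<Longrightarrow> d i \<ge> 0"
  shows "(\<exists>\<alpha>. generalised_tournament n \<alpha> \<and> is_score_sequence n \<alpha> d) \<longleftrightarrow>
    (\<forall>J. J \<subseteq> {1..n} \<longrightarrow> (\<Sum>i\<in>J. d i) \<ge> real (card J choose 2)) \<and>
    (\<Sum>i\<in>{1..n}. d i) = real (card {1..n} choose 2)"
    (is "?scores \<longleftrightarrow> ?bounds")
proof
  assume ?scores
  then obtain \<alpha> where \<alpha>: "generalised_tournament n \<alpha>" and d: "is_score_sequence n \<alpha> d"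
    by blast
  have sum_d: "(\<Sum>i\<in>J. d i) = (\<Sum>i\<in>J. outdegree n \<alpha> i)" if "J \<subseteq> {1..n}" for J
    using d that unfolding is_score_sequence_def by (intro sum.cong) auto
  show ?bounds
    using sum_outdegree_ge[OF \<alpha>] sum_outdegree_eq[OF \<alpha> order_refl] sum_d by simp
next
  assume ?bounds
  then show ?scores
    using tournament_with_scores_exists[of n d] by blast
qed

end
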